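(* Let $k$ be a commutative ring with $1/2\in k$ and $C$ a $\mathbb{Z}_{\ge0}$-graded conformal algebra over $k$. Then the operation $$[x,y]=\sum_{j\ge0}(-1)^j\partial^{(j+1)}(x_{(j)}y)\qquad(x,y\in C)$$ is a Lie bracket on the $k$-module $C$.
   Context: A $\mathbb{Z}_{\ge0}$-graded conformal algebra is a graded $k$-module $C=\oplus_{i\ge0}C_i$ with endomorphisms $\partial^{(j)}$ of degree $j$ ($j\ge0$), $\partial^{(0)}=\mathrm{Id}$, $\partial^{(i)}\partial^{(j)}=\binom{i+j}{i}\partial^{(i+j)}$, and bilinear operations $a_{(n)}b$ of degree $-n-1$ ($n\ge0$) such that for all $a,b,c\in C$ and $m,n,i\ge0$: $(\partial^{(i)}a)_{(n)}b=(-1)^i\binom ni a_{(n-i)}b$ (zero when $i>n$); $a_{(n)}b=(-1)^{n+1}\sum_{j\ge0}(-1)^j\partial^{(j)}(b_{(n+j)}a)$; $a_{(m)}(b_{(n)}c)=b_{(n)}(a_{(m)}c)+\sum_{j=0}^m\binom mj(a_{(j)}b)_{(m+n-j)}c$. Since the grading is bounded below all sums are finite. *)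

theory Defs
  imports Complex_Main "HOL-Library.Groups_Big_Fun"
begin

definition bilinear_op ::
  "('k::comm_ring_1 \<Rightarrow> 'c::ab_group_add \<Rightarrow> 'c) \<Rightarrow> ('c \<Rightarrow> 'c \<Rightarrow> 'c) \<Rightarrow> bool"
where
  "bilinear_op scale f \<longleftrightarrow>
     (\<forall>a. module_hom scale scale (\<lambda>b. f a b)) \<and> (\<forall>b. module_hom scale scale (\<lambda>a. f a b))"

text \<open>Internal grading: the whole module is the direct sum of the submodules \<open>G i\<close>.\<close>

locale graded_module = module scale
  for scale :: "'k::comm_ring_1 \<Rightarrow> 'c::ab_group_add \<Rightarrow> 'c" +
  fixes G :: "nat \<Rightarrow> 'c set"
  assumes subspace_G: "subspace (G i)"
    and direct_sum: "\<exists>!c :: nat \<Rightarrow> 'c. (\<forall>i. c i \<in> G i) \<and> finite {i. c i \<noteq> 0} \<and> x = Sum_any c"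

text \<open>
  \<open>D j\<close> is the divided power of the derivation and \<open>prd n a b\<close> is the \<open>n\<close>-th product of
  \<open>a\<close> and \<open>b\<close>. Since there are no components of negative degree, \<open>prd n\<close> being of degree
  \<open>- n - 1\<close> means that it vanishes on \<open>G p\<close>, \<open>G q\<close> when \<open>p + q < n + 1\<close>. For given
  \<open>a\<close>, \<open>b\<close> therefore \<open>prd n a b\<close> is nonzero for finitely many \<open>n\<close> only, so that the
  finite-support sum in \<open>skew_symmetry\<close> never takes its default value.
  In \<open>sesquilinearity\<close> the binomial coefficient, hence the right-hand side, is \<open>0\<close> if
  \<open>i > n\<close>, so truncated subtraction does no harm.
\<close>

locale graded_conformal_algebra = graded_module scale G
  for scale :: "'k::comm_ring_1 \<Rightarrow> 'c::ab_group_add \<Rightarrow> 'c" and G :: "nat \<Rightarrow> 'c set" +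
  fixes D :: "nat \<Rightarrow> 'c \<Rightarrow> 'c"
    and prd :: "nat \<Rightarrow> 'c \<Rightarrow> 'c \<Rightarrow> 'c"
  assumes D_hom: "module_hom scale scale (D j)"
    and D_degree: "a \<in> G p \<Longrightarrow> D j a \<in> G (p + j)"
    and D_0: "D 0 = id"
    and D_D: "D i (D j a) = scale (of_nat ((i + j) choose i)) (D (i + j) a)"
    and prd_bilinear: "bilinear_op scale (prd n)"
    and prd_degree: "a \<in> G p \<Longrightarrow> b \<in> G q \<Longrightarrow> n + 1 \<le> p + q \<Longrightarrow> prd n a b \<in> G (p + q - (n + 1))"
    and prd_degree_neg: "a \<in> G p \<Longrightarrow> b \<in> G q \<Longrightarrow> p + q < n + 1 \<Longrightarrow> prd n a b = 0"
    and sesquilinearity: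
      "prd n (D i a) b = scale ((- 1) ^ i * of_nat (n choose i)) (prd (n - i) a b)"
    and skew_symmetry:
      "prd n a b = scale ((- 1) ^ (n + 1)) (Sum_any (\<lambda>j. scale ((- 1) ^ j) (D j (prd (n + j) b a))))"
    and commutator_formula:
      "prd m a (prd n b c) =
         prd n b (prd m a c) + (\<Sum>j=0..m. scale (of_nat (m choose j)) (prd (m + n - j) (prd j a b) c))"

definition conformal_bracket ::
  "('k::comm_ring_1 \<Rightarrow> 'c::ab_group_add \<Rightarrow> 'c) \<Rightarrow> (nat \<Rightarrow> 'c \<Rightarrow> 'c) \<Rightarrow>
    (nat \<Rightarrow> 'c \<Rightarrow> 'c \<Rightarrow> 'c) \<Rightarrow> 'c \<Rightarrow> 'c \<Rightarrow> 'c"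
where
  "conformal_bracket scale D prd x y = (Sum_any (\<lambda>j. scale ((- 1) ^ j) (D (j + 1) (prd j x y))))"

locale lie_bracket = module scale
  for scale :: "'k::comm_ring_1 \<Rightarrow> 'c::ab_group_add \<Rightarrow> 'c" +
  fixes br :: "'c \<Rightarrow> 'c \<Rightarrow> 'c"
  assumes br_bilinear: "bilinear_op scale br"
    and br_alternating: "br x x = 0"
    and br_jacobi: "br x (br y z) + br y (br z x) + br z (br x y) = 0"

end

theory Submission
  imports Defs "HOL-Computational_Algebra.Formal_Power_Series"
begin

text \<open>
  Sesquilinearity turns \<open>[[x, y], z]\<close> into the sum over \<open>j \<le> N\<close> of
  \<open>(-1)^N (N + 1 choose j + 1) D (N + 2) ((x_j y)_(N - j) z)\<close>. Skew-symmetry of the products makes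
  the bracket skew-symmetric, so \<open>[x, [y, z]] = - [[y, z], x]\<close>; applying skew-symmetry of the
  products once more to this expansion and summing the binomial coefficients leaves the sum over
  \<open>m \<le> N\<close> of \<open>(-1)^N D (N + 2) (x_m (y_(N - m) z))\<close>. The coefficients here no longer depend on
  \<open>m\<close>, hence in \<open>[x, [y, z]] - [y, [x, z]]\<close> the commutator formula applies termwise, and the
  hockey-stick identity for the sum of \<open>m choose j\<close> over \<open>m \<le> N\<close> gives \<open>[[x, y], z]\<close>.
\<close>

section \<open>Finite sums and binomial identities\<close>

text \<open>Products vanish once the total index is large, so a double sum truncated to a square
  loses nothing when it is regrouped by the total index \<open>N\<close>.\<close>

lemma sum_square_by_diagonals:
  fixes f :: "nat \<Rightarrow> nat \<Rightarrow> 'a::comm_monoid_add"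
  assumes "\<And>i j. K \<le> i + j \<Longrightarrow> f i j = 0"
  shows "(\<Sum>i<K. \<Sum>j<K. f i j) = (\<Sum>N<K. \<Sum>i\<le>N. f i (N - i))"
proof -
  have "(\<Sum>i<K. \<Sum>j<K. f i j) = (\<Sum>(i, j)\<in>{..<K} \<times> {..<K}. f i j)"
    by (simp add: sum.cartesian_product)
  also have "\<dots> = (\<Sum>(i, j)\<in>{(i, j). i + j < K}. f i j)"
    by (rule sum.mono_neutral_right) (use assms not_less in auto)
  also have "\<dots> = (\<Sum>N<K. \<Sum>i\<le>N. f i (N - i))"
    by (rule sum.triangle_reindex)
  finally show ?thesis .
qed

lemma Sum_any_eq_sum_lessThan:
  fixes f :: "nat \<Rightarrow> 'a::comm_monoid_add"
  assumes "\<And>n. K \<le> n \<Longrightarrow> f n = 0"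
  shows "Sum_any f = (\<Sum>n<K. f n)"
  by (rule Sum_any.expand_superset) (use assms not_less in auto)

lemma alternating_binomial_sum:
  "(\<Sum>i\<le>n. (- 1) ^ i * of_nat (Suc n choose i)) = ((- 1) ^ n :: 'a::comm_ring_1)"
proof -
  have "(\<Sum>i\<le>Suc n. (- 1) ^ i * of_nat (Suc n choose i)) = (0 :: 'a)"
    by (rule choose_alternating_sum) simp
  then show ?thesis by (simp add: add_eq_0_iff)
qed

lemma alternating_binomial_convolution:
  "(\<Sum>p\<le>m. (- 1) ^ p * of_nat ((p + j + 1) choose (j + 1)) * of_nat ((m + j + 2) choose (m - p)))
     = (1 :: 'a::comm_ring_1)"
proof -
  let ?t = "\<lambda>p. (- 1) ^ p * of_nat ((p + j + 1) choose (j + 1)) * of_nat ((m + j + 2) choose (m - p))"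
  \<comment> \<open>The sum is the coefficient of \<open>u^m\<close> in \<open>(1 + u)^(- (j + 2)) * (1 + u)^(m + j + 2) = (1 + u)^m\<close>.\<close>
  have neg: "(- 1) ^ p * of_nat ((p + j + 1) choose (j + 1)) = (- of_nat (j + 2) :: real) gchoose p" for p
  proof -
    have "(p + j + 1) choose (j + 1) = (p + j + 1) choose p"
      using binomial_symmetric[of p "p + j + 1"] by simp
    then show ?thesis
      using gbinomial_minus[of "real (j + 2)" p] by (simp add: binomial_gbinomial add_ac del: binomial_Suc_Suc)
  qed
  have "(\<Sum>p\<le>m. ?t p :: real)
      = (\<Sum>p\<le>m. ((- of_nat (j + 2)) gchoose p) * ((of_nat (m + j + 2)) gchoose (m - p)))"
    unfolding neg by (simp only: binomial_gbinomial)
  also have "\<dots> = (- of_nat (j + 2) + of_nat (m + j + 2)) gchoose m"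
    unfolding atMost_atLeast0 by (rule gbinomial_Vandermonde)
  also have "\<dots> = of_nat m gchoose m" by simp
  also have "\<dots> = 1" by (simp flip: binomial_gbinomial)
  \<comment> \<open>The identity is between integers, so its real form descends to
    \<open>int\<close>, and \<open>of_int\<close> carries it to any commutative ring.\<close>
  finally have "real_of_int (\<Sum>p\<le>m. ?t p) = real_of_int 1" by simp
  then have "(\<Sum>p\<le>m. ?t p :: int) = 1" by (simp only: of_int_eq_iff)
  then have "of_int (\<Sum>p\<le>m. ?t p) = (of_int 1 :: 'a)" by (rule arg_cong)
  then show ?thesis by simp
qed

context graded_conformal_algebra
begin

section \<open>Linearity and finiteness of the products\<close>

lemma prd_hom_right: "module_hom scale scale (prd n a)"
  and prd_hom_left: "module_hom scale scale (\<lambda>a. prd n a b)"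
  using prd_bilinear[of n] by (auto simp: bilinear_op_def)

lemmas D_linear = module_hom.add[OF D_hom] module_hom.scale[OF D_hom] module_hom.sum[OF D_hom]
  module_hom.zero[OF D_hom] module_hom.neg[OF D_hom]

lemma D_D_right: "D i (D j a) = scale (of_nat ((i + j) choose j)) (D (i + j) a)"
  unfolding D_D using binomial_symmetric[of i "i + j"] by simp

lemmas prd_linear =
  module_hom.add[OF prd_hom_right] module_hom.scale[OF prd_hom_right]
  module_hom.sum[OF prd_hom_right] module_hom.zero[OF prd_hom_right]
  module_hom.add[OF prd_hom_left] module_hom.scale[OF prd_hom_left]
  module_hom.sum[OF prd_hom_left] module_hom.zero[OF prd_hom_left]

abbreviation br :: "'c \<Rightarrow> 'c \<Rightarrow> 'c" where
  "br \<equiv> conformal_bracket scale D prd"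

lemma homogeneous_decomposition:
  obtains c p where "\<And>i. c i \<in> G i" "x = (\<Sum>i<p. c i)"
proof -
  obtain c where c: "\<And>i. c i \<in> G i" "finite {i. c i \<noteq> 0}" "x = Sum_any c"
    using direct_sum[of x] by blast
  obtain p where "{i. c i \<noteq> 0} \<subseteq> {..<p}"
    using c(2) by (auto simp: finite_nat_set_iff_bounded)
  then have "Sum_any c = (\<Sum>i<p. c i)"
    by (intro Sum_any.expand_superset) auto
  with c show ?thesis using that by metis
qed

text \<open>The components of \<open>a\<close> and \<open>b\<close> have bounded degree, and the
  product of index \<open>n\<close> lowers the total degree by \<open>n + 1\<close>, eventually
  below zero. The filter form lets several truncation bounds be met at once.\<close>

lemma eventually_prd_eq_0: "\<forall>\<^sub>F K in sequentially. \<forall>n\<ge>K. prd n a b = 0"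
proof -
  obtain c p where c: "\<And>i. c i \<in> G i" "a = (\<Sum>i<p. c i)" using homogeneous_decomposition by blast
  obtain d q where d: "\<And>i. d i \<in> G i" "b = (\<Sum>i<q. d i)" using homogeneous_decomposition by blast
  have "prd n a b = 0" if "p + q \<le> n" for n
    using that c(1) d(1) unfolding c(2) d(2) prd_linear
    by (intro sum.neutral ballI prd_degree_neg) auto
  then show ?thesis unfolding eventually_sequentially by (metis order_trans)
qed

text \<open>Only indices \<open>n < L\<close> can give a nonzero inner product, and these finitely
  many share a bound \<open>M\<close> for \<open>m\<close>. If \<open>L + M \<le> m + n\<close>,
  then \<open>L \<le> n\<close> or \<open>M \<le> m\<close>.\<close>

lemma eventually_prd_prd_right_eq_0:
  "\<forall>\<^sub>F K in sequentially. \<forall>m n. K \<le> m + n \<longrightarrow> prd m a (prd n b c) = 0"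
proof -
  obtain L where L: "\<And>n. L \<le> n \<Longrightarrow> prd n b c = 0"
    using eventually_prd_eq_0[of b c] unfolding eventually_sequentially by blast
  have "\<forall>\<^sub>F K in sequentially. \<forall>n<L. \<forall>m\<ge>K. prd m a (prd n b c) = 0"
    using eventually_ball_finite[of "{..<L}" "\<lambda>K n. \<forall>m\<ge>K. prd m a (prd n b c) = 0" sequentially]
    by (simp add: eventually_prd_eq_0 Ball_def)
  then obtain M where M: "\<And>n m. n < L \<Longrightarrow> M \<le> m \<Longrightarrow> prd m a (prd n b c) = 0"
    unfolding eventually_sequentially by blast
  have "prd m a (prd n b c) = 0" if "L + M \<le> m + n" for m n
    using that L[of n] M[of n m] by (cases "n < L") (auto simp: prd_linear)
  then show ?thesis unfolding eventually_sequentially by (metis order_trans)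
qed

lemma eventually_prd_prd_left_eq_0:
  "\<forall>\<^sub>F K in sequentially. \<forall>m n. K \<le> m + n \<longrightarrow> prd n (prd m a b) c = 0"
proof -
  obtain L where L: "\<And>n. L \<le> n \<Longrightarrow> prd n a b = 0"
    using eventually_prd_eq_0[of a b] unfolding eventually_sequentially by blast
  have "\<forall>\<^sub>F K in sequentially. \<forall>m<L. \<forall>n\<ge>K. prd n (prd m a b) c = 0"
    using eventually_ball_finite[of "{..<L}" "\<lambda>K m. \<forall>n\<ge>K. prd n (prd m a b) c = 0" sequentially]
    by (simp add: eventually_prd_eq_0 Ball_def)
  then obtain M where M: "\<And>n m. m < L \<Longrightarrow> M \<le> n \<Longrightarrow> prd n (prd m a b) c = 0"
    unfolding eventually_sequentially by blast
  have "prd n (prd m a b) c = 0" if "L + M \<le> m + n" for m n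
    using that L[of m] M[of m n] by (cases "m < L") (auto simp: prd_linear)
  then show ?thesis unfolding eventually_sequentially by (metis order_trans)
qed

section \<open>Truncation, bilinearity and skew-symmetry of the bracket\<close>

lemma br_eq_sum:
  assumes "\<And>n. K \<le> n \<Longrightarrow> prd n x y = 0"
  shows "br x y = (\<Sum>j<K. scale ((- 1) ^ j) (D (j + 1) (prd j x y)))"
  unfolding conformal_bracket_def
  by (rule Sum_any_eq_sum_lessThan) (simp add: assms D_linear)

lemma eventually_br_eq_sum:
  "\<forall>\<^sub>F K in sequentially. br x y = (\<Sum>j<K. scale ((- 1) ^ j) (D (j + 1) (prd j x y)))"
  using eventually_prd_eq_0[of x y] by eventually_elim (blast intro: br_eq_sum)

lemma skew_symmetry_sum:
  assumes "\<And>j. K \<le> j \<Longrightarrow> prd (n + j) b a = 0"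
  shows "prd n a b = (\<Sum>j<K. scale ((- 1) ^ (n + 1 + j)) (D j (prd (n + j) b a)))"
  by (subst skew_symmetry, subst Sum_any_eq_sum_lessThan[of K])
    (simp_all add: assms D_linear scale_sum_right power_add)

lemma br_bilinear: "bilinear_op scale br"
proof -
  have add_right: "br x (y + z) = br x y + br x z" for x y z
  proof -
    \<comment> \<open>\<open>K\<close> is absent from the equation: it is a common truncation point
      for the three brackets, and a constant statement that holds eventually holds.\<close>
    have "\<forall>\<^sub>F K::nat in sequentially. br x (y + z) = br x y + br x z"
      using eventually_br_eq_sum[of x y] eventually_br_eq_sum[of x z] eventually_br_eq_sum[of x "y + z"]
      by eventually_elim (simp add: D_linear prd_linear scale_right_distrib sum.distrib)
    then show ?thesis by simp
  qed
  have add_left: "br (x + y) z = br x z + br y z" for x y z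
  proof -
    have "\<forall>\<^sub>F K::nat in sequentially. br (x + y) z = br x z + br y z"
      using eventually_br_eq_sum[of x z] eventually_br_eq_sum[of y z] eventually_br_eq_sum[of "x + y" z]
      by eventually_elim (simp add: D_linear prd_linear scale_right_distrib sum.distrib)
    then show ?thesis by simp
  qed
  have scale_right: "br x (scale r y) = scale r (br x y)" for x y r
  proof -
    have "\<forall>\<^sub>F K::nat in sequentially. br x (scale r y) = scale r (br x y)"
      using eventually_br_eq_sum[of x y] eventually_br_eq_sum[of x "scale r y"]
      by eventually_elim (simp add: D_linear prd_linear scale_sum_right mult.commute)
    then show ?thesis by simp
  qed
  have scale_left: "br (scale r x) y = scale r (br x y)" for x y r
  proof -
    have "\<forall>\<^sub>F K::nat in sequentially. br (scale r x) y = scale r (br x y)"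
      using eventually_br_eq_sum[of x y] eventually_br_eq_sum[of "scale r x" y]
      by eventually_elim (simp add: D_linear prd_linear scale_sum_right mult.commute)
    then show ?thesis by simp
  qed
  show ?thesis
    by (simp add: bilinear_op_def module_hom_iff module_axioms add_right add_left scale_right scale_left)
qed

text \<open>After skew-symmetry of the products, \<open>D (N + 1) (prd N x y)\<close> has as
  coefficient minus the alternating sum of \<open>Suc N choose i\<close> over
  \<open>i \<le> N\<close>. The full row sums to zero, so this is minus the sign
  \<open>(- 1) ^ N\<close> of the bracket.\<close>

lemma br_skew: "br y x = - br x y"
proof -
  obtain K where K: "\<And>n. K \<le> n \<Longrightarrow> prd n x y = 0" "\<And>n. K \<le> n \<Longrightarrow> prd n y x = 0"
    using eventually_conj[OF eventually_prd_eq_0[of x y] eventually_prd_eq_0[of y x]]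
    unfolding eventually_sequentially by blast
  let ?w = "\<lambda>N. D (N + 1) (prd N x y)"
  have skew: "prd j y x = (\<Sum>i<K. scale ((- 1) ^ (j + 1 + i)) (D i (prd (j + i) x y)))" for j
    by (rule skew_symmetry_sum) (simp add: K)
  have "br y x = (\<Sum>j<K. scale ((- 1) ^ j) (D (j + 1) (prd j y x)))"
    by (rule br_eq_sum) (rule K)
  also have "\<dots> = (\<Sum>j<K. scale ((- 1) ^ j) (D (j + 1)
      (\<Sum>i<K. scale ((- 1) ^ (j + 1 + i)) (D i (prd (j + i) x y)))))"
    by (simp only: skew)
  also have "\<dots> = (\<Sum>j<K. \<Sum>i<K. scale (- ((- 1) ^ i * of_nat ((j + i + 1) choose i))) (?w (j + i)))"
    by (intro sum.cong refl)
      (simp add: D_linear D_D_right scale_sum_right power_add mult_ac add_ac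
        del: binomial_Suc_Suc flip: power_mult_distrib)
  also have "\<dots> = (\<Sum>i<K. \<Sum>j<K. scale (- ((- 1) ^ i * of_nat ((j + i + 1) choose i))) (?w (j + i)))"
    by (rule sum.swap)
  also have "\<dots> = (\<Sum>N<K. \<Sum>i\<le>N. scale (- ((- 1) ^ i * of_nat ((N - i + i + 1) choose i))) (?w (N - i + i)))"
    by (rule sum_square_by_diagonals) (simp add: K D_linear)
  also have "\<dots> = (\<Sum>N<K. scale (- (\<Sum>i\<le>N. (- 1) ^ i * of_nat (Suc N choose i))) (?w N))"
    by (intro sum.cong refl) (simp add: scale_sum_left sum_negf[symmetric])
  also have "\<dots> = - (\<Sum>N<K. scale ((- 1) ^ N) (?w N))"
    unfolding alternating_binomial_sum by (simp add: sum_negf)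
  also have "\<dots> = - br x y"
    using br_eq_sum[of K x y] K(1) by simp
  finally show ?thesis .
qed

section \<open>Iterated brackets and the Jacobi identity\<close>

lemma eventually_br_br_left_eq_sum:
  "\<forall>\<^sub>F K in sequentially. br (br x y) z = (\<Sum>N<K. \<Sum>j\<le>N.
     scale ((- 1) ^ N * of_nat ((N + 1) choose (j + 1))) (D (N + 2) (prd (N - j) (prd j x y) z)))"
proof -
  \<comment> \<open>Index \<open>0\<close> contributes nothing to the outer sum, because the inner
    bracket consists of terms \<open>D (j + 1)\<close>. One more outer term and a shift make both
    sums run below \<open>K\<close>.\<close>
  have "\<forall>\<^sub>F K in sequentially.
      br (br x y) z = (\<Sum>i<Suc K. scale ((- 1) ^ i) (D (i + 1) (prd i (br x y) z)))"
    using eventually_br_eq_sum[of "br x y" z]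
    by (rule iffD2[OF eventually_sequentially_Suc])
  with eventually_br_eq_sum[of x y] show ?thesis
  proof eventually_elim
    case (elim K)
    let ?w = "\<lambda>N j. D (N + 2) (prd (N - j) (prd j x y) z)"
    \<comment> \<open>The sign \<open>(- 1) ^ j\<close> of the bracket and
      \<open>(- 1) ^ (j + 1)\<close> of \<open>sesquilinearity\<close> multiply to
      \<open>- 1\<close>.\<close>
    have prd_br: "prd i (br x y) z =
        (\<Sum>j<K. scale (- of_nat (i choose (j + 1))) (prd (i - (j + 1)) (prd j x y) z))" for i
      unfolding elim(1) by (simp add: prd_linear sesquilinearity flip: mult.assoc power_add)
    have "br (br x y) z = (\<Sum>N<K. scale ((- 1) ^ (N + 1)) (D (N + 2) (prd (N + 1) (br x y) z)))"
      unfolding elim(2) sum.lessThan_Suc_shift by (simp add: prd_br D_linear)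
    also have "\<dots> = (\<Sum>N<K. \<Sum>j<K. scale ((- 1) ^ N * of_nat ((N + 1) choose (j + 1))) (?w N j))"
      unfolding prd_br by (simp add: D_linear scale_sum_right del: binomial_Suc_Suc)
    also have "\<dots> = (\<Sum>N<K. \<Sum>j\<le>N. scale ((- 1) ^ N * of_nat ((N + 1) choose (j + 1))) (?w N j))"
      by (rule sum.cong[OF refl], rule sum.mono_neutral_right)
        (simp_all add: subset_iff binomial_eq_0 not_le del: binomial_Suc_Suc)
    finally show ?case .
  qed
qed

text \<open>\<open>sesquilinearity\<close> moves \<open>D\<close> out of the left factor only, so
  the outer bracket is flipped first and the products are flipped back afterwards.\<close>

lemma eventually_br_br_right_eq_sum:
  "\<forall>\<^sub>F K in sequentially. br x (br y z) = (\<Sum>N<K. \<Sum>m\<le>N.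
     scale ((- 1) ^ N) (D (N + 2) (prd m x (prd (N - m) y z))))"
  using eventually_br_br_left_eq_sum[of y z x] eventually_prd_prd_left_eq_0[of y z x]
    eventually_prd_prd_right_eq_0[of x y z]
proof eventually_elim
  case (elim K)
  note left = elim(2)[rule_format] and right = elim(3)[rule_format]
  let ?c = "\<lambda>p j. of_nat ((p + j + 1) choose (j + 1)) :: 'k"
  let ?w = "\<lambda>m j. D (m + j + 2) (prd m x (prd j y z))"
  have skew: "prd p (prd j y z) x = (\<Sum>i<K. scale ((- 1) ^ (p + 1 + i)) (D i (prd (p + i) x (prd j y z))))"
    for p j
    by (rule skew_symmetry_sum) (simp add: right)
  have "br x (br y z) = - br (br y z) x"
    by (rule br_skew)
  \<comment> \<open>\<open>N\<close> is written as \<open>j + (N - j)\<close> so that the regrouping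
    by diagonals can be undone.\<close>
  also have "br (br y z) x = (\<Sum>N<K. \<Sum>j\<le>N.
      scale ((- 1) ^ (j + (N - j)) * ?c (N - j) j) (D (j + (N - j) + 2) (prd (N - j) (prd j y z) x)))"
    unfolding elim(1) by (intro sum.cong refl) simp
  also have "\<dots> = (\<Sum>j<K. \<Sum>p<K. scale ((- 1) ^ (j + p) * ?c p j) (D (j + p + 2) (prd p (prd j y z) x)))"
    by (rule sum_square_by_diagonals[symmetric]) (simp add: left D_linear)
  also have "\<dots> = (\<Sum>j<K. \<Sum>p<K. scale ((- 1) ^ (j + p) * ?c p j) (D (j + p + 2)
      (\<Sum>i<K. scale ((- 1) ^ (p + 1 + i)) (D i (prd (p + i) x (prd j y z))))))"
    by (simp only: skew)
  also have "\<dots> = (\<Sum>j<K. \<Sum>p<K. \<Sum>i<K.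
      scale (- ((- 1) ^ (j + i) * ?c p j * of_nat ((p + i + j + 2) choose i))) (?w (p + i) j))"
    by (intro sum.cong refl) (simp add: D_linear D_D_right scale_sum_right power_add mult_ac add_ac
        del: binomial_Suc_Suc flip: power_mult_distrib)
  \<comment> \<open>For fixed \<open>j\<close>, the vector depends on \<open>p\<close> and
    \<open>i\<close> through \<open>m = p + i\<close> alone; the coefficients over \<open>p\<close>
    will then add up by \<open>alternating_binomial_convolution\<close>.\<close>
  also have "\<dots> = (\<Sum>j<K. \<Sum>m<K. \<Sum>p\<le>m.
      scale (- ((- 1) ^ (j + (m - p)) * ?c p j * of_nat ((p + (m - p) + j + 2) choose (m - p))))
        (?w (p + (m - p)) j))"
    by (intro sum.cong refl sum_square_by_diagonals) (simp add: right D_linear)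
  also have "\<dots> = (\<Sum>j<K. \<Sum>m<K. \<Sum>p\<le>m.
      scale (- ((- 1) ^ (m + j)) * ((- 1) ^ p * ?c p j * of_nat ((m + j + 2) choose (m - p)))) (?w m j))"
  proof (intro sum.cong refl)
    fix j m p :: nat assume "p \<in> {..m}"
    then have "(- 1 :: 'k) ^ (j + (m - p)) = (- 1) ^ (m + j) * (- 1) ^ p"
      by (auto simp: le_iff_add power_add mult_ac simp flip: power_mult_distrib)
    then show "scale (- ((- 1) ^ (j + (m - p)) * ?c p j * of_nat ((p + (m - p) + j + 2) choose (m - p))))
          (?w (p + (m - p)) j)
        = scale (- ((- 1) ^ (m + j)) * ((- 1) ^ p * ?c p j * of_nat ((m + j + 2) choose (m - p)))) (?w m j)"
      using \<open>p \<in> {..m}\<close> by (simp add: mult_ac del: binomial_Suc_Suc)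
  qed
  also have "\<dots> = (\<Sum>j<K. \<Sum>m<K. scale (- ((- 1) ^ (m + j))) (?w m j))"
    unfolding scale_sum_left[symmetric] sum_distrib_left[symmetric] alternating_binomial_convolution
    by simp
  also have "\<dots> = (\<Sum>m<K. \<Sum>j<K. scale (- ((- 1) ^ (m + j))) (?w m j))"
    by (rule sum.swap)
  also have "\<dots> = (\<Sum>N<K. \<Sum>m\<le>N. scale (- ((- 1) ^ (m + (N - m)))) (?w m (N - m)))"
    by (rule sum_square_by_diagonals) (simp add: right D_linear)
  also have "- \<dots> = (\<Sum>N<K. \<Sum>m\<le>N. scale ((- 1) ^ N) (D (N + 2) (prd m x (prd (N - m) y z))))"
    by (simp add: sum_negf)
  finally show ?case .
qed

text \<open>Leibniz form of the Jacobi identity. On each level \<open>N\<close> the three expansions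
  share \<open>(- 1) ^ N\<close> and \<open>D (N + 2)\<close>, so only the sums of products need
  comparing.\<close>

lemma br_br_commutator: "br x (br y z) = br y (br x z) + br (br x y) z"
proof -
  have "\<forall>\<^sub>F K::nat in sequentially. br x (br y z) = br y (br x z) + br (br x y) z"
    using eventually_br_br_right_eq_sum[of x y z] eventually_br_br_right_eq_sum[of y x z]
      eventually_br_br_left_eq_sum[of x y z]
  proof eventually_elim
    case (elim K)
    have commutator: "(\<Sum>m\<le>N. prd m x (prd (N - m) y z)) = (\<Sum>m\<le>N. prd m y (prd (N - m) x z))
        + (\<Sum>j\<le>N. scale (of_nat ((N + 1) choose (j + 1))) (prd (N - j) (prd j x y) z))" for N
    proof -
      \<comment> \<open>With \<open>n = N - m\<close> the outer index \<open>m + n - j\<close> is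
        \<open>N - j\<close>, independent of \<open>m\<close>, so that only
        \<open>m choose j\<close> is left to sum over \<open>m\<close>.\<close>
      have "(\<Sum>m\<le>N. prd m x (prd (N - m) y z)) = (\<Sum>m\<le>N. prd (N - m) y (prd m x z))
          + (\<Sum>m\<le>N. \<Sum>j=0..m. scale (of_nat (m choose j)) (prd (N - j) (prd j x y) z))"
        by (subst commutator_formula) (simp add: sum.distrib)
      also have "(\<Sum>m\<le>N. prd (N - m) y (prd m x z)) = (\<Sum>m\<le>N. prd m y (prd (N - m) x z))"
        by (subst sum.nat_diff_reindex[symmetric, of _ "Suc N", unfolded lessThan_Suc_atMost]) simp
      also have "(\<Sum>m\<le>N. \<Sum>j=0..m. scale (of_nat (m choose j)) (prd (N - j) (prd j x y) z))
          = (\<Sum>m\<le>N. \<Sum>j\<le>N. scale (of_nat (m choose j)) (prd (N - j) (prd j x y) z))"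
        by (rule sum.cong[OF refl], rule sum.mono_neutral_left) (auto simp: not_le binomial_eq_0)
      also have "\<dots> = (\<Sum>j\<le>N. \<Sum>m\<le>N. scale (of_nat (m choose j)) (prd (N - j) (prd j x y) z))"
        by (rule sum.swap)
      also have "\<dots> = (\<Sum>j\<le>N. scale (of_nat (\<Sum>m\<le>N. m choose j)) (prd (N - j) (prd j x y) z))"
        by (simp add: scale_sum_left)
      also have "\<dots> = (\<Sum>j\<le>N. scale (of_nat ((N + 1) choose (j + 1))) (prd (N - j) (prd j x y) z))"
        by (simp add: sum_choose_upper flip: atMost_atLeast0 del: binomial_Suc_Suc)
      finally show ?thesis .
    qed
    have "br x (br y z) = (\<Sum>N<K. scale ((- 1) ^ N) (D (N + 2) (\<Sum>m\<le>N. prd m x (prd (N - m) y z))))"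
      unfolding elim(1) by (simp add: D_linear scale_sum_right)
    also have "\<dots> = br y (br x z) + br (br x y) z"
      unfolding commutator elim(2,3)
      by (simp add: D_linear scale_sum_right scale_right_distrib sum.distrib del: binomial_Suc_Suc)
    finally show ?case .
  qed
  then show ?thesis by simp
qed

end

theorem theorem8p22:
  fixes scale :: "'k::comm_ring_1 \<Rightarrow> 'c::ab_group_add \<Rightarrow> 'c"
    and G :: "nat \<Rightarrow> 'c set"
    and D :: "nat \<Rightarrow> 'c \<Rightarrow> 'c"
    and prd :: "nat \<Rightarrow> 'c \<Rightarrow> 'c \<Rightarrow> 'c"
  assumes "(2::'k) dvd 1"
    and "graded_conformal_algebra scale G D prd"
  shows "lie_bracket scale (conformal_bracket scale D prd)"
proof -
  interpret graded_conformal_algebra scale G D prd by fact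
  obtain h :: 'k where h: "2 * h = 1" using assms(1) by (metis dvdE)
  show ?thesis
  proof
    show "bilinear_op scale br" by (rule br_bilinear)
    show "br x x = 0" for x
    proof -
      \<comment> \<open>Skew-symmetry gives only \<open>br x x + br x x = 0\<close>; the inverse
        \<open>h\<close> of \<open>2\<close> removes the factor.\<close>
      have "br x x = scale (2 * h) (br x x)" by (simp add: h)
      also have "\<dots> = scale h (br x x + br x x)"
        by (simp only: mult_2 scale_left_distrib scale_right_distrib)
      also have "br x x + br x x = 0"
        using br_skew[of x x] by (metis add.right_inverse)
      finally show ?thesis by simp
    qed
    show "br x (br y z) + br y (br z x) + br z (br x y) = 0" for x y z
    proof -
      \<comment> \<open>Two uses of skew-symmetry turn the Leibniz form into the cyclic one.\<close>
      have "br y (br z x) = - br y (br x z)"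
        using br_bilinear by (subst br_skew[of z x]) (auto simp: bilinear_op_def intro: module_hom.neg)
      then show ?thesis
        using br_br_commutator[of x y z] br_skew[of z "br x y"] by simp
    qed
  qed
qed

end
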